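(* For a nonnegative integer $n$, let $b_3(n)$ denote the number of $3$-regular partitions of $n$. Then, as a coefficientwise congruence of power series in $\mathbb{Z}[[q]]$, $$\sum_{n=0}^{\infty}b_{3}(34n+24)q^n\equiv \sum_{n=0}^{\infty}b_{3}(2n)q^{17n}\pmod 2,$$ and therefore, for all integers $n\ge 0$, $$b_3(2\cdot 17^2n+58)\equiv 0\pmod 2,$$ and, for all integers $k\geq 1$ and $n\ge 0$, $$b_3\left(2\cdot 17^{2k}n+17^{2k-2}\cdot 58+24\left(\frac{17^{2k-2}-1}{288}\right)\right)\equiv 0\pmod 2.$$
   Context: For a positive integer $\ell$, an $\ell$-regular partition of $n$ is a partition of $n$ none of whose parts is divisible by $\ell$; $b_\ell(n)$ denotes the number of $\ell$-regular partitions of $n$, with $b_\ell(0)=1$. Equivalently, $\sum_{n=0}^{\infty}b_{\ell}(n)q^n=\prod_{j=1}^{\infty}\frac{1-q^{\ell j}}{1-q^{j}}$. A congruence modulo $2$ between power series means congruence of all corresponding coefficients. *)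

theory Defs
  imports
    "HOL-Library.Multiset"
    "HOL-Computational_Algebra.Formal_Power_Series"
    "HOL-Number_Theory.Cong"
begin

definition is_partition :: "nat multiset \<Rightarrow> nat \<Rightarrow> bool" where
  "is_partition p n \<longleftrightarrow> (\<forall>i \<in># p. 0 < i) \<and> sum_mset p = n"

definition regular_partitions :: "nat \<Rightarrow> nat \<Rightarrow> nat multiset set" where
  "regular_partitions l n = {p. is_partition p n \<and> (\<forall>i \<in># p. \<not> l dvd i)}"

definition b :: "nat \<Rightarrow> nat \<Rightarrow> nat" where
  "b l n = card (regular_partitions l n)"

definition fps_cong :: "int fps \<Rightarrow> int fps \<Rightarrow> int \<Rightarrow> bool" where
  "fps_cong F G m \<longleftrightarrow> (\<forall>n. [fps_nth F n = fps_nth G n] (mod m))"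

text \<open>
  Since \<open>card\<close> is 0 on infinite sets, finiteness is needed for \<^const>\<open>b\<close> to be a genuine count.
\<close>

lemma size_le_sum_mset:
  fixes p :: "nat multiset"
  assumes "\<forall>i \<in># p. 0 < i"
  shows "size p \<le> sum_mset p"
  using assms by (induction p) auto

lemma finite_regular_partitions: "finite (regular_partitions l n)"
proof (rule finite_subset)
  show "regular_partitions l n \<subseteq> mset ` {xs. set xs \<subseteq> {..n} \<and> length xs \<le> n}"
  proof
    fix p assume "p \<in> regular_partitions l n"
    then have pos: "\<forall>i \<in># p. 0 < i" and sum: "sum_mset p = n"
      by (auto simp: regular_partitions_def is_partition_def)
    obtain xs where xs: "mset xs = p" using ex_mset by blast
    have "length xs \<le> n"
      using size_le_sum_mset[OF pos] sum xs by (metis size_mset)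
    moreover have "set xs \<subseteq> {..n}"
    proof
      fix x assume "x \<in> set xs"
      then have "x \<in># p" using xs by auto
      then obtain p' where "p = add_mset x p'" by (blast dest: multi_member_split)
      then show "x \<in> {..n}" using sum by auto
    qed
    ultimately show "p \<in> mset ` {xs. set xs \<subseteq> {..n} \<and> length xs \<le> n}"
      using xs by blast
  qed
  show "finite (mset ` {xs. set xs \<subseteq> {..n} \<and> length xs \<le> n})"
    by (intro finite_imageI finite_lists_length_le) simp
qed

lemma b_0: "b l 0 = 1"
proof -
  have "p = {#}" if "p \<in> regular_partitions l 0" for p
  proof -
    have "size p \<le> 0"
      using that size_le_sum_mset[of p]
      unfolding regular_partitions_def is_partition_def by (metis (mono_tags, lifting) mem_Collect_eq)
    then show ?thesis by simp
  qed
  moreover have "{#} \<in> regular_partitions l 0"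
    by (simp add: regular_partitions_def is_partition_def)
  ultimately have "regular_partitions l 0 = {{#}}" by blast
  then show ?thesis by (simp add: b_def)
qed

text \<open>
  The natural-number division \<open>(17 ^ (2 * k - 2) - 1) div 288\<close> is exact for \<open>k \<ge> 1\<close>.
\<close>

lemma dvd_288:
  fixes k :: nat
  assumes "k \<ge> 1"
  shows "(288 :: nat) dvd 17 ^ (2 * k - 2) - 1"
proof -
  have "[(289 :: nat) ^ (k - 1) = 1 ^ (k - 1)] (mod 288)"
    by (rule cong_pow) (simp add: cong_def)
  moreover have "(17 :: nat) ^ (2 * k - 2) = 289 ^ (k - 1)"
  proof -
    have "(17 :: nat) ^ (2 * (k - 1)) = (17 ^ 2) ^ (k - 1)"
      by (rule power_mult)
    moreover have "2 * k - 2 = 2 * (k - 1)" by simp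
    ultimately show ?thesis by simp
  qed
  ultimately show ?thesis
    by (metis cong_to_1_nat power_one)
qed

end

theory Submission
  imports Defs "HOL-Library.Z2"
begin

text \<open>
  Write \<open>f\<^sub>d\<close> for the product of all \<open>1 - q\<^bsup>dj\<^esup>\<close>; over the field with two elements
  \<open>f\<^sub>2\<^sub>d = f\<^sub>d\<^sup>2\<close>. Let \<open>S\<close> be the sum of 1 and of all \<open>q\<^bsup>m*m\<^esup>\<close> with \<open>m > 0\<close> prime to 3.
  Jacobi's triple product and the 3-dissection of \<open>f\<^sub>1\<^sup>3\<close>, which is the series of triangular numbers,
  give \<open>f\<^sub>1\<^sup>3 = f\<^sub>3 S\<close> modulo 2, so the generating function of \<open>b 3\<close> is \<open>f\<^sub>3 / f\<^sub>1 = f\<^sub>1\<^sup>2 / S\<close>. The even part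
  of \<open>S\<close> is \<open>S(q\<^sup>4)\<close>, the fourth power of \<open>S\<close>, hence the even part of \<open>f\<^sub>1\<^sup>2 / S\<close> is
  \<open>(f\<^sub>1 S)\<^sup>2\<close>, that is, \<open>b 3 (2 * n)\<close> has the parity of the \<open>n\<close>-th coefficient of \<open>f\<^sub>1 S\<close>.
  By the pentagonal number theorem this coefficient counts the representations
  \<open>24 * n + 1 = x\<^sup>2 + 24 * m\<^sup>2\<close> with \<open>m = 0\<close> or \<open>m\<close> prime to 3. As \<open>-24\<close> is not a square modulo 17,
  a representation of a multiple of 17 has \<open>x\<close> and \<open>m\<close> divisible by 17 and descends.
\<close>

text \<open>These default rules turn field arithmetic into bit operations.\<close>
declare add_bit_eq_xor [simp del] mult_bit_eq_and [simp del]

section \<open>Truncated equality of power series\<close>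

text \<open>Infinite products are compared with finite ones only through finitely many coefficients,
  which replaces convergence arguments.\<close>

definition fps_agree :: "nat \<Rightarrow> 'a::comm_ring_1 fps \<Rightarrow> 'a fps \<Rightarrow> bool" where
  "fps_agree n F G \<longleftrightarrow> (\<forall>i<n. fps_nth F i = fps_nth G i)"

lemma fps_agree_refl [simp]: "fps_agree n F F"
  by (simp add: fps_agree_def)

lemma fps_agree_sym: "fps_agree n F G \<Longrightarrow> fps_agree n G F"
  by (simp add: fps_agree_def)

lemma fps_agree_trans [trans]: "fps_agree n F G \<Longrightarrow> fps_agree n G H \<Longrightarrow> fps_agree n F H"
  by (simp add: fps_agree_def)

lemma fps_agree_mult:
  assumes "fps_agree n F G" "fps_agree n F' G'"
  shows "fps_agree n (F * F') (G * G')"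
  using assms by (auto simp: fps_agree_def fps_mult_nth intro!: sum.cong)

lemma fps_agree_sum:
  "(\<And>x. x \<in> A \<Longrightarrow> fps_agree n (F x) (G x)) \<Longrightarrow> fps_agree n (sum F A) (sum G A)"
  by (auto simp: fps_agree_def fps_sum_nth intro!: sum.cong)

lemma fps_agree_prod:
  "(\<And>x. x \<in> A \<Longrightarrow> fps_agree n (F x) (G x)) \<Longrightarrow> fps_agree n (prod F A) (prod G A)"
  by (induction A rule: infinite_finite_induct) (auto intro!: fps_agree_mult)

lemma fps_eqI_agree: "(\<And>n. fps_agree n F G) \<Longrightarrow> F = G"
  by (auto simp: fps_agree_def intro!: fps_ext)

lemma fps_agree_X_power_mult_zero: "n \<le> m \<Longrightarrow> fps_agree n (F * fps_X ^ m) 0"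
  by (simp add: fps_agree_def fps_X_power_mult_right_nth)

lemma fps_agree_add_X_power: "n \<le> m \<Longrightarrow> fps_agree n (F + fps_X ^ m) F"
  by (simp add: fps_agree_def)

lemma fps_agree_mult_cancel:
  fixes F :: "'a::field fps"
  assumes "fps_agree n (F * H) (G * H)" and "fps_nth H 0 \<noteq> 0"
  shows "fps_agree n F G"
proof -
  have "fps_agree n (F * H * inverse H) (G * H * inverse H)"
    by (intro fps_agree_mult assms fps_agree_refl)
  then show ?thesis
    using assms(2) by (simp add: mult.assoc inverse_mult_eq_1')
qed

section \<open>The q-binomial theorem\<close>

text \<open>The Gaussian binomial coefficient, given by a Pascal recurrence so that no division is
  involved. Where \<open>n - k\<close> truncates, its factor \<open>qbinomial q n k\<close> is
  0.\<close>

fun qbinomial :: "'a::comm_ring_1 \<Rightarrow> nat \<Rightarrow> nat \<Rightarrow> 'a" where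
  "qbinomial q n 0 = 1"
| "qbinomial q 0 (Suc k) = 0"
| "qbinomial q (Suc n) (Suc k) = qbinomial q n (Suc k) + q ^ (n - k) * qbinomial q n k"

lemma qbinomial_eq_0: "n < k \<Longrightarrow> qbinomial q n k = 0"
  by (induction q n k rule: qbinomial.induct) auto

lemma qbinomial_self [simp]: "qbinomial q n n = 1"
  by (induction n) (auto simp: qbinomial_eq_0)

definition qpoch :: "'a::comm_ring_1 \<Rightarrow> nat \<Rightarrow> 'a" where
  "qpoch q n = (\<Prod>i<n. 1 - q ^ Suc i)"

lemma qpoch_0 [simp]: "qpoch q 0 = 1"
  by (simp add: qpoch_def)

lemma qpoch_Suc [simp]: "qpoch q (Suc n) = qpoch q n * (1 - q ^ Suc n)"
  by (simp add: qpoch_def)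

text \<open>The usual quotient formula with denominators cleared. The induction rests on
  \<open>(1 - q^(n-k)) + q^(n-k) * (1 - q^(k+1)) = 1 - q^(n+1)\<close>.\<close>

lemma qbinomial_mult_qpoch:
  "k \<le> n \<Longrightarrow> qbinomial q n k * (qpoch q k * qpoch q (n - k)) = qpoch q n"
proof (induction q n k rule: qbinomial.induct)
  case (3 q n k)
  show ?case
  proof (cases "k = n")
    case False
    with 3 have kn: "Suc k \<le> n" by auto
    then obtain d where d: "n - k = Suc d" "n - Suc k = d" by (cases "n - k") auto
    have ih: "qbinomial q n (Suc k) * (qpoch q (Suc k) * qpoch q (n - Suc k)) = qpoch q n"
      "qbinomial q n k * (qpoch q k * qpoch q (n - k)) = qpoch q n"
      using 3 kn by auto
    have e: "q ^ Suc d * q ^ Suc k = q ^ Suc n"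
    proof -
      have "Suc d + Suc k = Suc n" using d kn by simp
      then show ?thesis by (metis power_add)
    qed
    have "qbinomial q (Suc n) (Suc k) * (qpoch q (Suc k) * qpoch q (Suc n - Suc k))
        = qbinomial q n (Suc k) * (qpoch q (Suc k) * qpoch q (n - Suc k)) * (1 - q ^ Suc d)
          + q ^ Suc d * (1 - q ^ Suc k) * (qbinomial q n k * (qpoch q k * qpoch q (n - k)))"
      using d by (simp add: algebra_simps)
    also have "\<dots> = qpoch q n * ((1 - q ^ Suc d) + q ^ Suc d * (1 - q ^ Suc k))"
      unfolding ih by (simp add: algebra_simps)
    also have "\<dots> = qpoch q n * (1 - q ^ Suc d * q ^ Suc k)"
      by (simp only: algebra_simps) simp
    finally show ?thesis by (simp only: e qpoch_Suc)
  qed (simp add: qbinomial_eq_0)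
qed auto

text \<open>The last factor \<open>x + y * q ^ n\<close> splits the sum into the parts
  \<open>A\<close> and \<open>B\<close>; their terms in \<open>y ^ Suc j\<close> merge by the
  recurrence of \<open>qbinomial\<close>.\<close>

lemma prod_add_mult_power_eq:
  fixes x y q :: "'a::comm_ring_1"
  shows "(\<Prod>i<n. x + y * q ^ i)
       = (\<Sum>j\<le>n. qbinomial q n j * q ^ (j choose 2) * y ^ j * x ^ (n - j))"
proof (induction n)
  case (Suc n)
  let ?t = "\<lambda>j. qbinomial q n j * q ^ (j choose 2) * y ^ j * x ^ (n - j)"
  have c: "Suc j choose 2 = (j choose 2) + j" for j
    by (simp add: numeral_2_eq_2)
  have A: "(\<Sum>j\<le>n. ?t j) * x = x ^ Suc n
      + (\<Sum>j\<le>n. qbinomial q n (Suc j) * q ^ (Suc j choose 2) * y ^ Suc j * x ^ (n - j))"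
  proof -
    have "(\<Sum>j\<le>n. ?t j) * x = (\<Sum>j\<le>Suc n. qbinomial q n j * q ^ (j choose 2) * y ^ j * x ^ (Suc n - j))"
      by (simp add: sum_distrib_right sum_distrib_left qbinomial_eq_0 Suc_diff_le mult_ac)
    also have "\<dots> = x ^ Suc n
      + (\<Sum>j\<le>n. qbinomial q n (Suc j) * q ^ (Suc j choose 2) * y ^ Suc j * x ^ (n - j))"
      by (subst sum.atMost_Suc_shift) (simp add: numeral_2_eq_2)
    finally show ?thesis .
  qed
  have B: "(\<Sum>j\<le>n. ?t j) * (y * q ^ n)
      = (\<Sum>j\<le>n. q ^ (n - j) * qbinomial q n j * q ^ (Suc j choose 2) * y ^ Suc j * x ^ (n - j))"
    unfolding sum_distrib_right
  proof (rule sum.cong)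
    fix j assume "j \<in> {..n}"
    then have "q ^ n = q ^ (n - j) * q ^ j" by (simp flip: power_add)
    then show "?t j * (y * q ^ n)
        = q ^ (n - j) * qbinomial q n j * q ^ (Suc j choose 2) * y ^ Suc j * x ^ (n - j)"
      by (simp add: c power_add mult_ac)
  qed simp
  have "(\<Prod>i<Suc n. x + y * q ^ i) = (\<Sum>j\<le>n. ?t j) * x + (\<Sum>j\<le>n. ?t j) * (y * q ^ n)"
    using Suc by (simp add: algebra_simps)
  also have "\<dots> = x ^ Suc n + (\<Sum>j\<le>n. qbinomial q (Suc n) (Suc j) * q ^ (Suc j choose 2) * y ^ Suc j * x ^ (n - j))"
    unfolding A B by (simp add: algebra_simps sum.distrib)
  also have "\<dots> = (\<Sum>j\<le>Suc n. qbinomial q (Suc n) j * q ^ (j choose 2) * y ^ j * x ^ (Suc n - j))"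
    by (subst sum.atMost_Suc_shift) (simp add: numeral_2_eq_2)
  finally show ?case .
qed (simp add: numeral_2_eq_2)

section \<open>Products over sets of exponents, modulo 2\<close>

text \<open>Factors with \<open>j > n\<close> do not affect coefficient \<open>n\<close>, so each
  coefficient comes from a finite product. Over \<open>bit\<close> the factor is also
  \<open>1 - fps_X ^ j\<close>.\<close>

definition eprod :: "nat set \<Rightarrow> bit fps" where
  "eprod S = Abs_fps (\<lambda>n. fps_nth (\<Prod>j\<in>S \<inter> {..n}. 1 + fps_X ^ j) n)"

lemma fps_agree_prod_mono:
  fixes U V :: "nat set"
  assumes "finite V" "U \<subseteq> V" "V \<inter> {..<n} \<subseteq> U"
  shows "fps_agree n (\<Prod>j\<in>V. 1 + fps_X ^ j :: 'a::comm_ring_1 fps) (\<Prod>j\<in>U. 1 + fps_X ^ j)"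
proof -
  have "fps_agree n (\<Prod>j\<in>V - U. 1 + fps_X ^ j :: 'a fps) (\<Prod>j\<in>V - U. 1)"
    using assms by (intro fps_agree_prod fps_agree_add_X_power) (meson DiffE IntI lessThan_iff not_le subsetD)
  then have "fps_agree n ((\<Prod>j\<in>V - U. 1 + fps_X ^ j :: 'a fps) * (\<Prod>j\<in>U. 1 + fps_X ^ j))
      (1 * (\<Prod>j\<in>U. 1 + fps_X ^ j))"
    by (intro fps_agree_mult) simp_all
  then show ?thesis
    using prod.subset_diff[OF assms(2,1), of "\<lambda>j. 1 + fps_X ^ j :: 'a fps"] by simp
qed

text \<open>The free choice of \<open>U\<close> lets each later identity use the finite product that
  suits its reindexing.\<close>

lemma eprod_agree:
  assumes "finite U" "U \<subseteq> S" "S \<inter> {..<n} \<subseteq> U"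
  shows "fps_agree n (eprod S) (\<Prod>j\<in>U. 1 + fps_X ^ j)"
  unfolding fps_agree_def
proof (intro allI impI)
  fix i assume i: "i < n"
  have "fps_agree (Suc i) (\<Prod>j\<in>U. 1 + fps_X ^ j :: bit fps) (\<Prod>j\<in>U \<inter> {..i}. 1 + fps_X ^ j)"
    using assms by (intro fps_agree_prod_mono) auto
  moreover have "U \<inter> {..i} = S \<inter> {..i}"
    using assms i by auto
  ultimately show "fps_nth (eprod S) i = fps_nth (\<Prod>j\<in>U. 1 + fps_X ^ j) i"
    by (simp add: fps_agree_def eprod_def)
qed

lemma eprod_nth_0: "0 \<notin> S \<Longrightarrow> fps_nth (eprod S) 0 = 1"
proof -
  assume "0 \<notin> S"
  then have "S \<inter> {0} = {}" by auto
  then show ?thesis by (simp add: eprod_def)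
qed

lemma eprod_neq_0: "0 \<notin> S \<Longrightarrow> eprod S \<noteq> 0"
  using eprod_nth_0 by fastforce

lemma eprod_Un:
  assumes "S \<inter> T = {}"
  shows "eprod (S \<union> T) = eprod S * eprod T"
proof (rule fps_eqI_agree)
  fix n
  have "fps_agree n (eprod (S \<union> T)) (\<Prod>j\<in>(S \<inter> {..<n}) \<union> (T \<inter> {..<n}). 1 + fps_X ^ j)"
    by (rule eprod_agree) auto
  also have "(\<Prod>j\<in>(S \<inter> {..<n}) \<union> (T \<inter> {..<n}). 1 + fps_X ^ j :: bit fps)
      = (\<Prod>j\<in>S \<inter> {..<n}. 1 + fps_X ^ j) * (\<Prod>j\<in>T \<inter> {..<n}. 1 + fps_X ^ j)"
    using assms by (intro prod.union_disjoint) auto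
  also have "fps_agree n \<dots> (eprod S * eprod T)"
    by (intro fps_agree_mult fps_agree_sym[OF eprod_agree]) auto
  finally show "fps_agree n (eprod (S \<union> T)) (eprod S * eprod T)" .
qed

lemma bit_fps_2_eq_0 [simp]: "(2::bit fps) = 0"
  by (simp add: numeral_fps_const)

lemma bit_fps_diff: "F - G = (F + G :: bit fps)"
  by (rule fps_ext) simp

lemma bit_fps_power2_add: "(F + G)\<^sup>2 = F\<^sup>2 + (G :: bit fps)\<^sup>2"
proof -
  have "(F + G)\<^sup>2 = F\<^sup>2 + G\<^sup>2 + (F * G + F * G)"
    by (simp add: power2_eq_square algebra_simps)
  then show ?thesis by simp
qed

text \<open>Squaring is additive in characteristic 2, so it doubles the exponent in every
  factor.\<close>

lemma eprod_power2: "(eprod S)\<^sup>2 = eprod ((*) 2 ` S)"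
proof (rule fps_eqI_agree)
  fix n
  have "fps_agree n ((eprod S)\<^sup>2) ((\<Prod>j\<in>S \<inter> {..<n}. 1 + fps_X ^ j)\<^sup>2)"
    unfolding power2_eq_square by (intro fps_agree_mult eprod_agree) auto
  also have "(\<Prod>j\<in>S \<inter> {..<n}. 1 + fps_X ^ j :: bit fps)\<^sup>2
      = (\<Prod>j\<in>(*) 2 ` (S \<inter> {..<n}). 1 + fps_X ^ j)"
    by (subst prod.reindex)
       (auto simp: inj_on_def prod_power_distrib bit_fps_power2_add mult.commute simp flip: power_mult)
  also have "fps_agree n \<dots> (eprod ((*) 2 ` S))"
    by (rule fps_agree_sym[OF eprod_agree]) auto
  finally show "fps_agree n ((eprod S)\<^sup>2) (eprod ((*) 2 ` S))" .
qed

section \<open>Jacobi's triple product\<close>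

text \<open>The exponent is \<open>r * (k * (k + 1) / 2) + s * (k * (k - 1) / 2)\<close>.\<close>
definition texp :: "nat \<Rightarrow> nat \<Rightarrow> int \<Rightarrow> nat" where
  "texp r s k = nat ((int (r + s) * k\<^sup>2 + (int r - int s) * k) div 2)"

text \<open>Neither \<open>div\<close> nor \<open>nat\<close> loses anything in \<open>texp\<close>,
  because \<open>k * (k + 1)\<close> and \<open>k * (k - 1)\<close> are even and
  nonnegative.\<close>

lemma two_texp: "2 * int (texp r s k) = int (r + s) * k\<^sup>2 + (int r - int s) * k"
proof -
  have eq: "int (r + s) * k\<^sup>2 + (int r - int s) * k = int r * (k * (k + 1)) + int s * (k * (k - 1))"
    by (simp add: power2_eq_square algebra_simps)
  have "0 \<le> k * (k + 1)" "0 \<le> k * (k - 1)"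
    by (auto simp: zero_le_mult_iff)
  then have "0 \<le> int r * (k * (k + 1)) + int s * (k * (k - 1))"
    by (intro add_nonneg_nonneg mult_nonneg_nonneg[OF of_nat_0_le_iff])
  moreover have "even (int r * (k * (k + 1)) + int s * (k * (k - 1)))"
    by auto
  moreover have "2 * int (nat (y div 2)) = y" if "0 \<le> y" "even y" for y :: int
    using that by simp
  ultimately show ?thesis
    unfolding texp_def eq by blast
qed

text \<open>Already \<open>k * k\<close> is a lower bound, attained at \<open>r = s = 1\<close>.
  Hence only indices with absolute value below \<open>n\<close> matter below degree
  \<open>n\<close>.\<close>

lemma abs_le_texp:
  assumes "0 < r" "0 < s"
  shows "\<bar>k\<bar> \<le> int (texp r s k)"
proof -
  have "0 \<le> k * (k + 1)" "0 \<le> k * (k - 1)"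
    by (auto simp: zero_le_mult_iff)
  then have "1 * (k * (k + 1)) + 1 * (k * (k - 1)) \<le> int r * (k * (k + 1)) + int s * (k * (k - 1))"
    using assms by (intro add_mono mult_right_mono) auto
  also have "\<dots> = 2 * int (texp r s k)"
    unfolding two_texp by (simp add: power2_eq_square algebra_simps)
  finally have "k * k \<le> int (texp r s k)" by (simp add: algebra_simps)
  moreover have "\<bar>k\<bar> \<le> k * k"
    using mult_mono[of 1 "\<bar>k\<bar>" "\<bar>k\<bar>" "\<bar>k\<bar>"] by (cases "k = 0") (auto simp: abs_mult_self_eq)
  ultimately show ?thesis by linarith
qed

text \<open>A collision at \<open>k \<noteq> l\<close> would make \<open>s - r\<close> a multiple of
  \<open>r + s\<close>, but it is nonzero and smaller in absolute value.\<close>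

lemma inj_texp:
  assumes "0 < r" "0 < s" "r \<noteq> s"
  shows "inj (texp r s)"
proof (rule injI)
  fix k l assume "texp r s k = texp r s l"
  then have "int (r + s) * k\<^sup>2 + (int r - int s) * k = int (r + s) * l\<^sup>2 + (int r - int s) * l"
    using two_texp by metis
  then have "(k - l) * (int (r + s) * (k + l) + (int r - int s)) = 0"
    by (simp add: power2_eq_square algebra_simps)
  moreover have "int (r + s) * (k + l) + (int r - int s) \<noteq> 0"
  proof
    assume "int (r + s) * (k + l) + (int r - int s) = 0"
    then have "int (r + s) * (k + l) = int s - int r" by simp
    then have "int (r + s) dvd int s - int r" by (metis dvd_triv_left)
    then have "int (r + s) \<le> \<bar>int s - int r\<bar>"
      using assms(3) dvd_imp_le_int[of "int s - int r" "int (r + s)"] by auto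
    then show False using assms by auto
  qed
  ultimately show "k = l" by simp
qed

lemma prod_lessThan_add:
  fixes f :: "nat \<Rightarrow> 'a::comm_monoid_mult"
  shows "(\<Prod>i<m + n. f i) = (\<Prod>i<m. f i) * (\<Prod>i<n. f (m + i))"
  by (induction n) (auto simp: mult.assoc)

text \<open>
  This is the q-binomial theorem for \<open>2 * n\<close> factors with \<open>x = X\<^bsup>cn\<^esup>\<close>, \<open>y = X\<^sup>r\<close>, \<open>q = X\<^sup>c\<close>:
  multiplying by a power of \<open>X\<close> avoids the negative exponents of the usual form.
\<close>
lemma finite_triple_product:
  fixes r s n :: nat
  defines "c \<equiv> r + s"
  shows "(\<Prod>i<n. 1 + fps_X ^ (r + c * i)) * (\<Prod>i<n. 1 + fps_X ^ (s + c * i))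
    = (\<Sum>j\<le>2 * n. qbinomial (fps_X ^ c) (2 * n) j * fps_X ^ texp r s (int j - int n) :: 'a::idom fps)"
    (is "?L r * ?L s = (\<Sum>j\<le>_. ?G j * _)")
proof -
  define t where "t = (\<Sum>i<n. r + c * i)"
  have t: "2 * int t = 2 * int r * int n + int c * (int n * (int n - 1))"
    unfolding t_def by (induction n) (auto simp: algebra_simps)
  have low: "(\<Prod>i<n. fps_X ^ (c * n) + fps_X ^ r * (fps_X ^ c) ^ i) = fps_X ^ t * (?L s :: 'a fps)"
  proof -
    have "(\<Prod>i<n. fps_X ^ (c * n) + fps_X ^ r * (fps_X ^ c) ^ i :: 'a fps)
        = (\<Prod>i<n. fps_X ^ (r + c * i) * (1 + fps_X ^ (s + c * (n - Suc i))))"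
    proof (rule prod.cong)
      fix i assume "i \<in> {..<n}"
      then obtain d where "n = Suc (i + d)" using less_imp_Suc_add by auto
      then have "c * n = (r + c * i) + (s + c * (n - Suc i))"
        by (simp add: c_def algebra_simps)
      then have "fps_X ^ (c * n) = (fps_X ^ (r + c * i) * fps_X ^ (s + c * (n - Suc i)) :: 'a fps)"
        by (simp only: power_add)
      then show "fps_X ^ (c * n) + fps_X ^ r * (fps_X ^ c) ^ i
          = fps_X ^ (r + c * i) * (1 + fps_X ^ (s + c * (n - Suc i)) :: 'a fps)"
        by (simp add: algebra_simps power_add power_mult)
    qed simp
    also have "\<dots> = fps_X ^ t * (\<Prod>i<n. 1 + fps_X ^ (s + c * (n - Suc i)))"
      by (simp add: prod.distrib t_def power_sum)
    also have "(\<Prod>i<n. 1 + fps_X ^ (s + c * (n - Suc i))) = (?L s :: 'a fps)"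
      by (rule prod.nat_diff_reindex)
    finally show ?thesis .
  qed
  have high: "(\<Prod>i<n. fps_X ^ (c * n) + fps_X ^ r * (fps_X ^ c) ^ (n + i))
      = fps_X ^ (c * n * n) * (?L r :: 'a fps)"
  proof -
    have "(\<Prod>i<n. fps_X ^ (c * n) + fps_X ^ r * (fps_X ^ c) ^ (n + i) :: 'a fps)
        = (\<Prod>i<n. fps_X ^ (c * n) * (1 + fps_X ^ (r + c * i)))"
      by (intro prod.cong) (simp_all add: algebra_simps power_add flip: power_mult)
    then show ?thesis by (simp add: prod.distrib flip: power_mult)
  qed
  have "fps_X ^ (t + c * n * n) * (?L r * ?L s)
      = (\<Prod>i<n + n. fps_X ^ (c * n) + fps_X ^ r * (fps_X ^ c) ^ i :: 'a fps)"
    unfolding prod_lessThan_add low high by (simp add: power_add mult_ac)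
  also have "\<dots> = (\<Sum>j\<le>2 * n. ?G j * (fps_X ^ c) ^ (j choose 2) * (fps_X ^ r) ^ j * (fps_X ^ (c * n)) ^ (2 * n - j))"
    unfolding prod_add_mult_power_eq by (simp add: mult_2)
  also have "\<dots> = (\<Sum>j\<le>2 * n. ?G j * (fps_X ^ (t + c * n * n) * fps_X ^ texp r s (int j - int n)))"
  proof (rule sum.cong)
    fix j assume j: "j \<in> {..2 * n}"
    have ch: "2 * int (j choose 2) = int j * (int j - 1)"
      by (induction j) (auto simp: numeral_2_eq_2 algebra_simps)
    have "2 * int (c * (j choose 2) + r * j + c * n * (2 * n - j))
        = int c * (2 * int (j choose 2)) + 2 * int r * int j + 2 * int c * int n * (2 * int n - int j)"
    proof -
      have d: "int (2 * n - j) = 2 * int n - int j" using j by simp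
      show ?thesis by (simp only: of_nat_add of_nat_mult d) (simp add: algebra_simps)
    qed
    also have "\<dots> = 2 * int t + 2 * int c * int n * int n + 2 * int (texp r s (int j - int n))"
      unfolding ch t two_texp c_def by (simp add: power2_eq_square algebra_simps)
    also have "\<dots> = 2 * int (t + c * n * n + texp r s (int j - int n))"
      by simp
    finally have "c * (j choose 2) + r * j + c * n * (2 * n - j)
        = t + c * n * n + texp r s (int j - int n)"
      by (metis mult_left_cancel zero_neq_numeral of_nat_eq_iff)
    then show "?G j * (fps_X ^ c) ^ (j choose 2) * (fps_X ^ r) ^ j * (fps_X ^ (c * n)) ^ (2 * n - j)
        = ?G j * (fps_X ^ (t + c * n * n) * fps_X ^ texp r s (int j - int n))"
      by (simp add: mult.assoc flip: power_add power_mult)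
  qed simp
  also have "\<dots> = fps_X ^ (t + c * n * n) * (\<Sum>j\<le>2 * n. ?G j * fps_X ^ texp r s (int j - int n))"
    by (simp add: sum_distrib_left mult_ac)
  finally show ?thesis by simp
qed

text \<open>
  For \<open>r \<noteq> s\<close> the exponents are pairwise distinct, so every coefficient of the theta series is 0 or 1.
\<close>
definition theta :: "nat \<Rightarrow> nat \<Rightarrow> bit fps" where
  "theta r s = Abs_fps (\<lambda>n. of_bool (n \<in> range (texp r s)))"

lemma eprod_range_agree:
  assumes "0 < c" "n \<le> m"
  shows "fps_agree n (eprod (range (\<lambda>i. r + c * i))) (\<Prod>i<m. 1 + fps_X ^ (r + c * i))"
proof -
  have "fps_agree n (eprod (range (\<lambda>i. r + c * i))) (\<Prod>j\<in>(\<lambda>i. r + c * i) ` {..<m}. 1 + fps_X ^ j)"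
  proof (rule eprod_agree)
    have "i < m" if "r + c * i < n" for i
    proof -
      have "1 * i \<le> c * i" using assms(1) by (intro mult_right_mono) auto
      then have "i \<le> c * i" by simp
      then show ?thesis using that assms(2) by linarith
    qed
    then show "range (\<lambda>i. r + c * i) \<inter> {..<n} \<subseteq> (\<lambda>i. r + c * i) ` {..<m}" by auto
  qed auto
  also have "(\<Prod>j\<in>(\<lambda>i. r + c * i) ` {..<m}. 1 + fps_X ^ j :: bit fps) = (\<Prod>i<m. 1 + fps_X ^ (r + c * i))"
    using assms(1) by (subst prod.reindex) (auto simp: inj_on_def)
  finally show ?thesis .
qed

text \<open>Limit of the finite version: after multiplication by \<open>?E\<close>, the coefficients
  near the centre \<open>j = N\<close> become 1 below degree \<open>n\<close>, and the other terms
  start at degree \<open>n\<close> or later.\<close>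

lemma triple_product:
  assumes "0 < r" "0 < s" "r \<noteq> s" and c_def: "c = r + s"
  shows "eprod (range (\<lambda>i. r + c * i)) * eprod (range (\<lambda>i. s + c * i)) * eprod (range (\<lambda>i. c + c * i))
    = theta r s" (is "?A * ?B * ?E = _")
proof (rule fps_eqI_agree)
  fix n :: nat
  \<comment> \<open>If \<open>j\<close> is at distance less than \<open>n\<close> from
    \<open>N\<close>, then both \<open>j\<close> and \<open>2 * N - j\<close> are at least
    \<open>n\<close>.\<close>
  define N where "N = 2 * n"
  have c: "0 < c" using assms by simp
  let ?e = "\<lambda>j. texp r s (int j - int N)"
  let ?G = "qbinomial (fps_X ^ c :: bit fps) (2 * N)"
  have E0: "fps_nth ?E 0 \<noteq> 0"
    using c by (subst eprod_nth_0) auto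
  have E: "fps_agree n (qpoch (fps_X ^ c) m) ?E" if "n \<le> m" for m
  proof -
    have "qpoch (fps_X ^ c) m = (\<Prod>i<m. 1 + fps_X ^ (c + c * i) :: bit fps)"
      by (simp add: qpoch_def bit_fps_diff power_add power_mult)
    then show ?thesis
      using eprod_range_agree[OF c that] fps_agree_sym by metis
  qed
  \<comment> \<open>All three q-Pochhammer symbols of the quotient formula agree with
    \<open>?E\<close> below degree \<open>n\<close>, so \<open>?G j\<close> agrees with
    \<open>1 / ?E\<close>.\<close>
  have G: "fps_agree n (?G j * ?E) 1" if "n \<le> j" "j \<le> 2 * N - n" for j
  proof -
    have "j \<le> 2 * N" "n \<le> 2 * N - j" "n \<le> 2 * N" using that N_def by auto
    then have "fps_agree n (?G j * (?E * ?E)) (?G j * (qpoch (fps_X ^ c) j * qpoch (fps_X ^ c) (2 * N - j)))"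
      using that by (intro fps_agree_mult fps_agree_refl fps_agree_sym[OF E])
    also have "\<dots> = qpoch (fps_X ^ c) (2 * N)"
      by (rule qbinomial_mult_qpoch) fact
    also have "fps_agree n \<dots> ?E" by (rule E) fact
    finally have "fps_agree n ((?G j * ?E) * ?E) (1 * ?E)" by (simp add: mult.assoc)
    then show ?thesis using E0 by (rule fps_agree_mult_cancel)
  qed
  have "fps_agree n (?A * ?B * ?E)
      ((\<Prod>i<N. 1 + fps_X ^ (r + c * i)) * (\<Prod>i<N. 1 + fps_X ^ (s + c * i)) * ?E)"
    using c by (intro fps_agree_mult eprod_range_agree fps_agree_refl) (auto simp: N_def)
  also have "\<dots> = (\<Sum>j\<le>2 * N. ?G j * ?E * fps_X ^ ?e j)"
    unfolding c_def finite_triple_product by (simp add: sum_distrib_left sum_distrib_right mult_ac)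
  also have "fps_agree n \<dots> (\<Sum>j\<le>2 * N. fps_X ^ ?e j)"
  proof (rule fps_agree_sum)
    fix j assume j: "j \<in> {..2 * N}"
    show "fps_agree n (?G j * ?E * fps_X ^ ?e j) (fps_X ^ ?e j)"
    proof (cases "n \<le> ?e j")
      case True
      then have "fps_agree n (?G j * ?E * fps_X ^ ?e j) 0" "fps_agree n (1 * fps_X ^ ?e j :: bit fps) 0"
        by (rule fps_agree_X_power_mult_zero)+
      then show ?thesis using fps_agree_sym fps_agree_trans by (metis mult_1)
    next
      case False
      then have "\<bar>int j - int N\<bar> < int n"
        using abs_le_texp[OF assms(1,2), of "int j - int N"] by linarith
      then have "n \<le> j" "j \<le> 2 * N - n" unfolding N_def by linarith+
      then have "fps_agree n (?G j * ?E * fps_X ^ ?e j) (1 * fps_X ^ ?e j)"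
        by (intro fps_agree_mult G fps_agree_refl)
      then show ?thesis by simp
    qed
  qed
  also have "fps_agree n \<dots> (theta r s)"
    unfolding fps_agree_def
  proof (intro allI impI)
    fix m assume m: "m < n"
    have "fps_nth (\<Sum>j\<le>2 * N. fps_X ^ ?e j) m = (\<Sum>j\<le>2 * N. if m = ?e j then 1 else 0 :: bit)"
      by (simp add: fps_sum_nth)
    also have "\<dots> = of_bool (m \<in> range (texp r s))"
    proof (cases "m \<in> range (texp r s)")
      case True
      then obtain k where k: "m = texp r s k" by auto
      have "\<bar>k\<bar> < int n" using m k abs_le_texp[OF assms(1,2), of k] by linarith
      then have mem: "nat (int N + k) \<in> {..2 * N}" and kN: "int (nat (int N + k)) = int N + k"
        by (auto simp: N_def)
      have "(m = ?e j) = (j = nat (int N + k))" for j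
        unfolding k using inj_eq[OF inj_texp[OF assms(1-3)], of k "int j - int N"] kN by auto
      then show ?thesis using True mem by (simp add: sum.delta)
    next
      case False
      then show ?thesis by (auto intro!: sum.neutral)
    qed
    finally show "fps_nth (\<Sum>j\<le>2 * N. fps_X ^ ?e j) m = fps_nth (theta r s) m"
      by (simp add: theta_def)
  qed
  finally show "fps_agree n (?A * ?B * ?E) (theta r s)" .
qed

text \<open>Turns exponents of theta series into an integer quadratic equation, free of
  \<open>nat\<close> and \<open>div\<close>.\<close>

lemma in_range_texp_iff:
  "n \<in> range (texp r s) \<longleftrightarrow> (\<exists>k. 2 * int n = int (r + s) * k\<^sup>2 + (int r - int s) * k)"
proof -
  have "n = texp r s k \<longleftrightarrow> 2 * int n = int (r + s) * k\<^sup>2 + (int r - int s) * k" for k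
    unfolding two_texp[symmetric] by auto
  then show ?thesis by auto
qed

section \<open>Substitution of a power of the variable\<close>

lemma fps_compose_X_power_nth:
  fixes F :: "'a::comm_ring_1 fps"
  assumes "0 < m"
  shows "fps_nth (F oo fps_X ^ m) n = (if m dvd n then fps_nth F (n div m) else 0)"
proof -
  have "fps_nth (F oo fps_X ^ m) n = (\<Sum>i=0..n. if n = m * i then fps_nth F i else 0)"
    by (auto simp: fps_compose_nth simp flip: power_mult intro!: sum.cong)
  also have "\<dots> = (if m dvd n then fps_nth F (n div m) else 0)"
  proof (cases "m dvd n")
    case True
    then have "n = m * i \<longleftrightarrow> i = n div m" for i using assms by auto
    moreover have "n div m \<le> n" by (rule div_le_dividend)
    ultimately show ?thesis using True by (simp add: sum.delta)
  next
    case False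
    then show ?thesis by (auto intro!: sum.neutral)
  qed
  finally show ?thesis .
qed

lemma fps_compose_mult_X_power:
  fixes F G :: "'a::idom fps"
  assumes "0 < m"
  shows "(F * G) oo fps_X ^ m = (F oo fps_X ^ m) * (G oo fps_X ^ m)"
  using assms by (intro fps_compose_mult_distrib) simp

lemma fps_compose_power_X_power:
  fixes F :: "'a::idom fps"
  assumes "0 < m"
  shows "F ^ n oo fps_X ^ m = (F oo fps_X ^ m) ^ n"
  using assms by (induction n) (simp_all add: fps_compose_mult_X_power)

lemma fps_agree_compose_X_power:
  assumes "0 < m" "fps_agree n F G"
  shows "fps_agree n (F oo fps_X ^ m) (G oo fps_X ^ m)"
  using assms unfolding fps_agree_def
  by (auto simp: fps_compose_X_power_nth intro: le_less_trans[OF div_le_dividend])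

lemma eprod_compose_X_power:
  assumes "0 < m"
  shows "eprod S oo fps_X ^ m = eprod ((*) m ` S)"
proof (rule fps_eqI_agree)
  fix n
  have "fps_agree n (eprod S oo fps_X ^ m) ((\<Prod>j\<in>S \<inter> {..<n}. 1 + fps_X ^ j) oo fps_X ^ m)"
    by (intro fps_agree_compose_X_power assms eprod_agree) auto
  also have "(\<Prod>j\<in>S \<inter> {..<n}. 1 + fps_X ^ j :: bit fps) oo fps_X ^ m = (\<Prod>j\<in>S \<inter> {..<n}. 1 + fps_X ^ (m * j))"
    using assms by (simp add: fps_compose_prod_distrib fps_compose_add_distrib fps_compose_power_X_power power_mult)
  also have "\<dots> = (\<Prod>j\<in>(*) m ` (S \<inter> {..<n}). 1 + fps_X ^ j)"
    using assms by (subst prod.reindex) (auto simp: inj_on_def)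
  also have "fps_agree n \<dots> (eprod ((*) m ` S))"
  proof (rule fps_agree_sym[OF eprod_agree])
    have "j < n" if "m * j < n" for j
    proof -
      have "1 * j \<le> m * j" using assms by (intro mult_right_mono) auto
      then have "j \<le> m * j" by simp
      then show ?thesis using that by linarith
    qed
    then show "(*) m ` S \<inter> {..<n} \<subseteq> (*) m ` (S \<inter> {..<n})" by auto
  qed auto
  finally show "fps_agree n (eprod S oo fps_X ^ m) (eprod ((*) m ` S))" .
qed

section \<open>Euler products and theta series\<close>

definition euler :: "nat \<Rightarrow> bit fps" where
  "euler d = eprod {j. 0 < j \<and> d dvd j}"

lemma euler_neq_0 [simp]: "euler d \<noteq> 0"
  unfolding euler_def by (rule eprod_neq_0) simp

lemma euler_mult_eq_image:
  fixes m d :: nat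
  assumes "0 < m"
  shows "{j. 0 < j \<and> m * d dvd j} = (*) m ` {j. 0 < j \<and> d dvd j}"
proof (intro equalityI subsetI)
  fix j assume "j \<in> {j. 0 < j \<and> m * d dvd j}"
  then have "0 < j" "m * d dvd j" by auto
  from this(2) obtain k where "j = m * d * k" ..
  then have "j = m * (d * k)" by simp
  with \<open>0 < j\<close> show "j \<in> (*) m ` {j. 0 < j \<and> d dvd j}" by (intro image_eqI[of _ _ "d * k"]) auto
qed (use assms in auto)

lemma euler_compose: "0 < m \<Longrightarrow> euler d oo fps_X ^ m = euler (m * d)"
  unfolding euler_def by (simp add: eprod_compose_X_power euler_mult_eq_image)

lemma euler_double: "euler (2 * d) = (euler d)\<^sup>2"
  unfolding euler_def eprod_power2 by (simp add: euler_mult_eq_image)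

lemma range_add_mult: "range (\<lambda>i. r + c * i) = {j::nat. r \<le> j \<and> c dvd j - r}"
  by (auto elim!: dvdE simp: image_iff) (metis le_add_diff_inverse)

text \<open>Euler's pentagonal number theorem: the three progressions modulo 3 exhaust the positive
  integers.\<close>

lemma theta_1_2: "theta 1 2 = euler 1"
proof -
  have "theta 1 2 = eprod (range (\<lambda>i. 1 + 3 * i)) * eprod (range (\<lambda>i. 2 + 3 * i)) * eprod (range (\<lambda>i. 3 + 3 * i))"
    by (rule triple_product[symmetric]) simp_all
  also have "\<dots> = eprod (range (\<lambda>i. 1 + 3 * i) \<union> range (\<lambda>i. 2 + 3 * i) \<union> range (\<lambda>i. 3 + 3 * i))"
  proof -
    have "range (\<lambda>i. 1 + 3 * i) \<inter> range (\<lambda>i. 2 + 3 * i) = ({}::nat set)"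
      unfolding range_add_mult by (auto; presburger)
    moreover have "(range (\<lambda>i. 1 + 3 * i) \<union> range (\<lambda>i. 2 + 3 * i)) \<inter> range (\<lambda>i. 3 + 3 * i) = ({}::nat set)"
      unfolding range_add_mult by (auto; presburger)
    ultimately show ?thesis by (simp only: eprod_Un)
  qed
  also have "range (\<lambda>i. 1 + 3 * i) \<union> range (\<lambda>i. 2 + 3 * i) \<union> range (\<lambda>i. 3 + 3 * i) = {j::nat. 0 < j \<and> 1 dvd j}"
    unfolding range_add_mult by (auto; presburger)
  finally show ?thesis by (simp add: euler_def)
qed

text \<open>The exponents \<open>2 * k^2 - k\<close> are the triangular numbers. The product runs
  over the odd numbers and the multiples of 4, giving
  \<open>(f_1 / f_2) * f_4 = (f_1 / f_1^2) * f_1^4\<close>.\<close>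

lemma theta_1_3: "theta 1 3 = (euler 1) ^ 3"
proof -
  have t: "theta 1 3 = eprod (range (\<lambda>i. 1 + 4 * i)) * eprod (range (\<lambda>i. 3 + 4 * i)) * eprod (range (\<lambda>i. 4 + 4 * i))"
    by (rule triple_product[symmetric]) simp_all
  have "range (\<lambda>i. 1 + 4 * i) \<inter> range (\<lambda>i. 3 + 4 * i) = ({}::nat set)"
    unfolding range_add_mult by (auto; presburger)
  moreover have "range (\<lambda>i. 1 + 4 * i) \<union> range (\<lambda>i. 3 + 4 * i) = {j::nat. odd j}"
    unfolding range_add_mult by (auto; presburger)
  ultimately have o: "eprod (range (\<lambda>i. 1 + 4 * i)) * eprod (range (\<lambda>i. 3 + 4 * i)) = eprod {j. odd j}"
    using eprod_Un by metis
  have "range (\<lambda>i. 4 + 4 * i) = {j::nat. 0 < j \<and> 4 dvd j}"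
    unfolding range_add_mult by (auto; presburger)
  then have "eprod (range (\<lambda>i. 4 + 4 * i)) = (euler 1) ^ 4"
    using euler_double[of 1] euler_double[of 2] by (simp add: euler_def)
  with t o have t: "theta 1 3 = eprod {j. odd j} * (euler 1) ^ 4" by simp
  have "{j::nat. 0 < j \<and> 1 dvd j} = {j. odd j} \<union> {j. 0 < j \<and> 2 dvd j}"
    by (auto simp: odd_pos)
  then have "euler 1 = eprod {j. odd j} * (euler 1)\<^sup>2"
    using eprod_Un[of "{j. odd j}" "{j. 0 < j \<and> 2 dvd j}"] euler_double[of 1]
    by (auto simp: euler_def)
  then have "theta 1 3 = euler 1 * (euler 1)\<^sup>2"
    using t by (metis (no_types, lifting) mult.assoc numeral_Bit0 power_add one_add_one mult_2 power2_eq_square power4_eq_xxxx)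
  then show ?thesis by (simp add: power2_eq_square power3_eq_cube)
qed

text \<open>The product is \<open>u * f_6 = u * f_3^2\<close>. Splitting \<open>f_1\<close> and
  \<open>f_3\<close> by parity of the exponents gives \<open>u * v * f_1 = 1\<close> and
  \<open>v * f_3 = 1\<close>, so \<open>u = f_3 / f_1\<close>.\<close>

lemma theta_1_5: "theta 1 5 * euler 1 = (euler 3) ^ 3"
proof -
  define u where "u = eprod {j. odd j \<and> \<not> 3 dvd j}"
  define v where "v = eprod {j. odd j \<and> 3 dvd j}"
  have t: "theta 1 5 = eprod (range (\<lambda>i. 1 + 6 * i)) * eprod (range (\<lambda>i. 5 + 6 * i)) * eprod (range (\<lambda>i. 6 + 6 * i))"
    by (rule triple_product[symmetric]) simp_all
  have "range (\<lambda>i. 1 + 6 * i) \<inter> range (\<lambda>i. 5 + 6 * i) = ({}::nat set)"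
    unfolding range_add_mult by (auto; presburger)
  moreover have "range (\<lambda>i. 1 + 6 * i) \<union> range (\<lambda>i. 5 + 6 * i) = {j::nat. odd j \<and> \<not> 3 dvd j}"
    unfolding range_add_mult by (auto; presburger)
  ultimately have "eprod (range (\<lambda>i. 1 + 6 * i)) * eprod (range (\<lambda>i. 5 + 6 * i)) = u"
    using eprod_Un u_def by metis
  moreover have "range (\<lambda>i. 6 + 6 * i) = {j::nat. 0 < j \<and> 6 dvd j}"
    unfolding range_add_mult by (auto; presburger)
  ultimately have t: "theta 1 5 = u * (euler 3)\<^sup>2"
    using t euler_double[of 3] by (simp add: euler_def)
  have "eprod ({j. odd j \<and> \<not> 3 dvd j} \<union> {j. odd j \<and> 3 dvd j} \<union> {j. 0 < j \<and> 2 dvd j}) = u * v * euler 2"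
    unfolding u_def v_def euler_def by (subst eprod_Un, blast)+ simp
  moreover have "{j. odd j \<and> \<not> 3 dvd j} \<union> {j. odd j \<and> 3 dvd j} \<union> {j. 0 < j \<and> 2 dvd j} = {j::nat. 0 < j \<and> 1 dvd j}"
    by (auto simp: odd_pos)
  ultimately have "1 * euler 1 = (u * v * euler 1) * euler 1"
    using euler_double[of 1] by (simp add: euler_def power2_eq_square mult.assoc)
  then have 1: "u * v * euler 1 = 1"
    by (metis mult_right_cancel euler_neq_0)
  have "eprod ({j. odd j \<and> 3 dvd j} \<union> {j. 0 < j \<and> 6 dvd j}) = v * euler 6"
    unfolding v_def euler_def by (subst eprod_Un) (auto dest: dvd_trans[of 2 6])
  moreover have "{j. odd j \<and> 3 dvd j} \<union> {j. 0 < j \<and> 6 dvd j} = {j::nat. 0 < j \<and> 3 dvd j}"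
    by (auto simp: odd_pos; presburger)
  ultimately have "1 * euler 3 = (v * euler 3) * euler 3"
    using euler_double[of 3] by (simp add: euler_def power2_eq_square mult.assoc)
  then have 3: "v * euler 3 = 1"
    by (metis mult_right_cancel euler_neq_0)
  have "theta 1 5 * euler 1 = u * (euler 3)\<^sup>2 * euler 1 * (v * euler 3)"
    unfolding t 3 by simp
  also have "\<dots> = (u * v * euler 1) * (euler 3) ^ 3"
    by (simp add: power2_eq_square power3_eq_cube mult_ac)
  finally show ?thesis by (simp only: 1 mult_1)
qed

section \<open>The 3-dissection of the cube of the Euler product\<close>

text \<open>Sort \<open>n = 2 * k^2 - k\<close> by \<open>k\<close> modulo 3: residues 0 and 2 give
  three times the pentagonal numbers of even and odd index, residue 1 gives
  \<open>9 * (2 * l^2 + l) + 1\<close>.\<close>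

lemma range_texp_1_3_iff:
  "n \<in> range (texp 1 3) \<longleftrightarrow>
     (\<exists>m. n = 3 * m \<and> m \<in> range (texp 1 2)) \<or> (\<exists>m. n = 9 * m + 1 \<and> m \<in> range (texp 1 3))"
  (is "?L \<longleftrightarrow> ?A \<or> ?B")
proof
  assume ?L
  then obtain k where "2 * int n = 4 * k\<^sup>2 - 2 * k" by (auto simp: in_range_texp_iff)
  then have k: "int n = 2 * k\<^sup>2 - k" by simp
  consider l where "k = 3 * l" | l where "k = 3 * l + 1" | l where "k = 3 * l + 2"
  proof -
    have "k = 3 * (k div 3) + k mod 3" by simp
    moreover have "k mod 3 \<in> {0, 1, 2}" by auto
    ultimately show ?thesis using that by (metis add.right_neutral empty_iff insertE)
  qed
  then show "?A \<or> ?B"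
  proof cases
    case 1
    have "int n = 3 * (6 * l\<^sup>2 - l)" using k 1 by (simp add: power2_eq_square)
    then obtain m where m: "n = 3 * m" "int m = 6 * l\<^sup>2 - l"
      by (metis dvd_triv_left int_dvd_int_iff of_nat_numeral dvdE of_nat_mult mult_left_cancel zero_neq_numeral)
    then have "2 * int m = 3 * (2 * l)\<^sup>2 - 2 * l" by (simp add: power2_eq_square)
    then have "m \<in> range (texp 1 2)" unfolding in_range_texp_iff by (intro exI[of _ "2 * l"]) simp
    then show ?thesis using m by auto
  next
    case 2
    define z where "z = 2 * l\<^sup>2 + l"
    have "int n = 9 * z + 1" using k 2 by (simp add: z_def power2_eq_square algebra_simps)
    then have "0 \<le> z" using of_nat_0_le_iff[of n] by linarith
    then have z: "int (nat z) = z" by simp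
    then have n: "n = 9 * nat z + 1" using \<open>int n = 9 * z + 1\<close> by linarith
    have "2 * int (nat z) = 4 * (- l)\<^sup>2 - 2 * (- l)" unfolding z by (simp add: z_def)
    then have "nat z \<in> range (texp 1 3)"
      unfolding in_range_texp_iff by (intro exI[of _ "- l"]) simp
    then show ?thesis using n by auto
  next
    case 3
    have "int n = 3 * (6 * l\<^sup>2 + 7 * l + 2)" using k 3 by (simp add: power2_eq_square algebra_simps)
    then obtain m where m: "n = 3 * m" "int m = 6 * l\<^sup>2 + 7 * l + 2"
      by (metis dvd_triv_left int_dvd_int_iff of_nat_numeral dvdE of_nat_mult mult_left_cancel zero_neq_numeral)
    then have "2 * int m = 3 * (- (2 * l + 1))\<^sup>2 - (- (2 * l + 1))"
      by (simp add: power2_eq_square algebra_simps)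
    then have "m \<in> range (texp 1 2)"
      unfolding in_range_texp_iff by (intro exI[of _ "- (2 * l + 1)"]) simp
    then show ?thesis using m by auto
  qed
next
  assume "?A \<or> ?B"
  then show ?L
  proof
    assume ?A
    then obtain m k where m: "n = 3 * m" and k: "2 * int m = 3 * k\<^sup>2 - k"
      by (auto simp: in_range_texp_iff)
    show ?L
    proof (cases "even k")
      case True
      then obtain j where "k = 2 * j" by auto
      then show ?L
        using m k unfolding in_range_texp_iff by (intro exI[of _ "3 * j"]) (simp add: power2_eq_square)
    next
      case False
      then obtain j where "k = 2 * j + 1" by (auto elim: oddE)
      then show ?L
        using m k unfolding in_range_texp_iff
        by (intro exI[of _ "- 3 * j - 1"]) (simp add: power2_eq_square algebra_simps)
    qed
  next
    assume ?B
    then obtain m k where n: "n = 9 * m + 1" and "2 * int m = 4 * k\<^sup>2 - 2 * k"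
      by (auto simp: in_range_texp_iff)
    then have "int m = 2 * k\<^sup>2 - k" by simp
    with n show ?L
      unfolding in_range_texp_iff
      by (intro exI[of _ "1 - 3 * k"]) (simp add: power2_eq_square algebra_simps)
  qed
qed

text \<open>The two kinds of exponents are disjoint, as only the first are divisible by 3; so the
  indicator coefficients add without cancelling in \<open>bit\<close>.\<close>

lemma theta_1_3_dissection: "theta 1 3 = (theta 1 2 oo fps_X ^ 3) + fps_X * (theta 1 3 oo fps_X ^ 9)"
proof (rule fps_ext)
  fix n
  show "fps_nth (theta 1 3) n = fps_nth ((theta 1 2 oo fps_X ^ 3) + fps_X * (theta 1 3 oo fps_X ^ 9)) n"
  proof (cases "3 dvd n")
    case True
    then obtain m where m: "n = 3 * m" by auto
    have "fps_nth (fps_X * (theta 1 3 oo fps_X ^ 9)) n = 0"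
    proof (cases n)
      case (Suc l)
      have "\<not> 9 dvd l" using m Suc by presburger
      then show ?thesis using Suc by (simp add: fps_compose_X_power_nth)
    qed simp
    moreover have "n \<in> range (texp 1 3) \<longleftrightarrow> m \<in> range (texp 1 2)"
    proof -
      have "n \<noteq> 9 * l + 1" for l using m by presburger
      then show ?thesis using range_texp_1_3_iff[of n] m by auto
    qed
    ultimately show ?thesis using m
      by (simp add: fps_compose_X_power_nth theta_def del: One_nat_def)
  next
    case False
    then obtain l where l: "n = Suc l" by (cases n) auto
    have "n \<in> range (texp 1 3) \<longleftrightarrow> 9 dvd l \<and> l div 9 \<in> range (texp 1 3)"
      by (subst range_texp_1_3_iff) (use l False in auto)
    then show ?thesis using l False
      by (simp add: fps_compose_X_power_nth theta_def del: One_nat_def)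
  qed
qed

text \<open>The series \<open>S\<close>. The constant term has its own clause because 0 is a
  multiple of 3.\<close>

definition square_series :: "bit fps" where
  "square_series = Abs_fps (\<lambda>n. of_bool (n = 0 \<or> (\<exists>m. \<not> 3 dvd m \<and> n = m\<^sup>2)))"

text \<open>If 3 does not divide \<open>m\<close>, then \<open>m\<close> or \<open>- m\<close> has
  the form \<open>3 * k - 1\<close>, and its square is
  \<open>1 + 3 * (3 * k^2 - 2 * k)\<close>.\<close>

lemma square_series_eq: "square_series = 1 + fps_X * (theta 1 5 oo fps_X ^ 3)"
proof (rule fps_ext)
  fix n
  show "fps_nth square_series n = fps_nth (1 + fps_X * (theta 1 5 oo fps_X ^ 3)) n"
  proof (cases n)
    case (Suc l)
    have "(\<exists>m. \<not> 3 dvd m \<and> Suc l = m\<^sup>2) \<longleftrightarrow> 3 dvd l \<and> l div 3 \<in> range (texp 1 5)"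
    proof
      assume "\<exists>m. \<not> 3 dvd m \<and> Suc l = m\<^sup>2"
      then obtain m where m: "\<not> 3 dvd m" "Suc l = m\<^sup>2" by auto
      obtain k where k: "int m = 3 * k - 1 \<or> int m = - (3 * k - 1)"
      proof -
        from m(1) have "m mod 3 = 1 \<or> m mod 3 = 2" by presburger
        then have "int m = 3 * int (m div 3) + 1 \<or> int m = 3 * int (m div 3) + 2" by presburger
        then show ?thesis using that[of "- int (m div 3)"] that[of "int (m div 3) + 1"] by auto
      qed
      have "int l + 1 = (int m)\<^sup>2" using m(2) by (metis of_nat_Suc of_nat_power add.commute)
      also have "\<dots> = (3 * k - 1)\<^sup>2" using k by (metis power2_minus)
      finally have l: "int l = 3 * (3 * k\<^sup>2 - 2 * k)" by (simp add: power2_eq_square algebra_simps)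
      then obtain i where i: "l = 3 * i" "int i = 3 * k\<^sup>2 - 2 * k"
        by (metis dvd_triv_left int_dvd_int_iff of_nat_numeral dvdE of_nat_mult mult_left_cancel zero_neq_numeral)
      then have "i \<in> range (texp 1 5)"
        unfolding in_range_texp_iff by (intro exI[of _ k]) simp
      then show "3 dvd l \<and> l div 3 \<in> range (texp 1 5)" using i by simp
    next
      assume "3 dvd l \<and> l div 3 \<in> range (texp 1 5)"
      then obtain i k where "l = 3 * i" "2 * int i = 6 * k\<^sup>2 - 4 * k"
        by (auto simp: in_range_texp_iff elim!: dvdE)
      then have i: "l = 3 * i" "int i = 3 * k\<^sup>2 - 2 * k" by auto
      have "int (Suc l) = (3 * k - 1)\<^sup>2" using i by (simp add: power2_eq_square algebra_simps)
      then have "int (Suc l) = int ((nat \<bar>3 * k - 1\<bar>)\<^sup>2)" by simp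
      then have "Suc l = (nat \<bar>3 * k - 1\<bar>)\<^sup>2" by (simp only: of_nat_eq_iff)
      moreover have "\<not> int 3 dvd 3 * k - 1" by presburger
      then have "\<not> 3 dvd nat \<bar>3 * k - 1\<bar>" by (simp only: dvd_nat_abs_iff not_False_eq_True)
      ultimately show "\<exists>m. \<not> 3 dvd m \<and> Suc l = m\<^sup>2" by blast
    qed
    then show ?thesis using Suc
      by (simp add: square_series_def theta_def fps_compose_X_power_nth)
  qed (simp add: square_series_def)
qed

text \<open>The dissection reads \<open>f_1^3 = f_3 + q * f_9^3\<close>, and
  \<open>theta_1_5\<close> at \<open>q^3\<close> shows that \<open>f_9^3\<close> is divisible by
  \<open>f_3\<close>.\<close>

lemma euler_1_power3: "(euler 1) ^ 3 = euler 3 * square_series"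
proof -
  have "(theta 1 5 oo fps_X ^ 3) * euler 3 = (euler 1) ^ 3 oo fps_X ^ 9"
    using arg_cong[OF theta_1_5, of "\<lambda>F. F oo fps_X ^ 3"]
    by (simp add: fps_compose_mult_X_power fps_compose_power_X_power euler_compose)
  then have "euler 3 * square_series = euler 3 + fps_X * ((euler 1) ^ 3 oo fps_X ^ 9)"
    unfolding square_series_eq by (simp add: algebra_simps)
  then show ?thesis
    using theta_1_3_dissection euler_compose[of 3 1] by (simp add: theta_1_2 theta_1_3 del: One_nat_def)
qed

section \<open>The generating function of regular partitions\<close>

definition parts_in :: "nat set \<Rightarrow> nat \<Rightarrow> nat multiset set" where
  "parts_in S n = {p. set_mset p \<subseteq> S \<and> sum_mset p = n}"

text \<open>The case \<open>l = 0\<close> of regular partitions covers all partitions, since 0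
  divides only 0.\<close>

lemma finite_parts_in: "0 \<notin> S \<Longrightarrow> finite (parts_in S n)"
  by (rule finite_subset[OF _ finite_regular_partitions[of 0 n]])
     (auto simp: parts_in_def regular_partitions_def is_partition_def subset_iff intro: gr0I)

text \<open>Removing one copy of \<open>j\<close> is a bijection from the partitions containing
  \<open>j\<close> to the partitions of \<open>n - j\<close>.\<close>

lemma card_parts_in_insert:
  assumes "0 \<notin> insert j S" "j \<notin> S"
  shows "card (parts_in (insert j S) n)
       = card (parts_in S n) + (if j \<le> n then card (parts_in (insert j S) (n - j)) else 0)"
proof -
  have "parts_in (insert j S) n = parts_in S n \<union> {p \<in> parts_in (insert j S) n. j \<in># p}"
    by (auto simp: parts_in_def)
  moreover have "parts_in S n \<inter> {p \<in> parts_in (insert j S) n. j \<in># p} = {}"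
    using assms(2) by (auto simp: parts_in_def)
  ultimately have "card (parts_in (insert j S) n)
      = card (parts_in S n) + card {p \<in> parts_in (insert j S) n. j \<in># p}"
    using card_Un_disjoint[of "parts_in S n" "{p \<in> parts_in (insert j S) n. j \<in># p}"]
      finite_parts_in[of S n] finite_parts_in[of "insert j S" n] assms(1) by simp
  moreover have "card {p \<in> parts_in (insert j S) n. j \<in># p}
      = (if j \<le> n then card (parts_in (insert j S) (n - j)) else 0)"
  proof (cases "j \<le> n")
    case True
    have "{p \<in> parts_in (insert j S) n. j \<in># p} = add_mset j ` parts_in (insert j S) (n - j)"
    proof (intro equalityI subsetI)
      fix p assume p: "p \<in> {p \<in> parts_in (insert j S) n. j \<in># p}"
      then obtain p' where "p = add_mset j p'" by (auto dest: multi_member_split)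
      then show "p \<in> add_mset j ` parts_in (insert j S) (n - j)"
        using p by (auto simp: parts_in_def)
    qed (use True in \<open>auto simp: parts_in_def\<close>)
    then show ?thesis using True by (simp add: card_image inj_on_def)
  next
    case False
    then have "{p \<in> parts_in (insert j S) n. j \<in># p} = {}"
      by (auto simp: parts_in_def dest!: multi_member_split)
    then show ?thesis using False by (simp only: card.empty if_False)
  qed
  ultimately show ?thesis by simp
qed

lemma parts_in_generating_function:
  assumes "finite S" "0 \<notin> S"
  shows "Abs_fps (\<lambda>n. of_nat (card (parts_in S n))) * (\<Prod>j\<in>S. 1 - fps_X ^ j) = (1 :: 'a::comm_ring_1 fps)"
  using assms
proof (induction S rule: finite_induct)
  case empty
  have "parts_in {} n = (if n = 0 then {{#}} else {})" for n
    by (auto simp: parts_in_def)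
  then show ?case by (auto intro!: fps_ext)
next
  case (insert j S)
  let ?F = "\<lambda>S. Abs_fps (\<lambda>n. of_nat (card (parts_in S n))) :: 'a fps"
  have "?F (insert j S) = ?F S + ?F (insert j S) * fps_X ^ j"
  proof (rule fps_ext)
    fix n
    show "fps_nth (?F (insert j S)) n = fps_nth (?F S + ?F (insert j S) * fps_X ^ j) n"
      using card_parts_in_insert[OF insert.prems insert.hyps(2), of n]
      by (simp add: fps_X_power_mult_right_nth)
  qed
  then have "?F (insert j S) * (1 - fps_X ^ j) = ?F S" by (simp add: algebra_simps)
  then show ?case using insert by (simp flip: mult.assoc)
qed

definition regular_gf :: "nat \<Rightarrow> bit fps" where
  "regular_gf l = Abs_fps (\<lambda>n. of_nat (b l n))"

lemma regular_gf_mult_eprod: "regular_gf l * eprod {j. 0 < j \<and> \<not> l dvd j} = 1"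
proof (rule fps_eqI_agree)
  fix n :: nat
  let ?S = "{j. 0 < j \<and> \<not> l dvd j} \<inter> {..<n}"
  \<comment> \<open>No part exceeds the sum, so the parts may be restricted to those below
    \<open>n\<close>.\<close>
  have "regular_partitions l i = parts_in ?S i" if "i < n" for i
  proof -
    have "x \<le> sum_mset p" if "x \<in># p" for x and p :: "nat multiset"
      using that by (auto dest!: multi_member_split)
    then show ?thesis
      using \<open>i < n\<close> unfolding regular_partitions_def is_partition_def parts_in_def
      by (auto intro: le_less_trans)
  qed
  then have "fps_agree n (regular_gf l) (Abs_fps (\<lambda>n. of_nat (card (parts_in ?S n))))"
    by (simp add: fps_agree_def regular_gf_def b_def)
  then have "fps_agree n (regular_gf l * eprod {j. 0 < j \<and> \<not> l dvd j})
      (Abs_fps (\<lambda>n. of_nat (card (parts_in ?S n))) * (\<Prod>j\<in>?S. 1 + fps_X ^ j))"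
    by (intro fps_agree_mult eprod_agree) auto
  also have "\<dots> = 1"
    using parts_in_generating_function[of ?S, where 'a = bit] by (simp add: bit_fps_diff)
  finally show "fps_agree n (regular_gf l * eprod {j. 0 < j \<and> \<not> l dvd j}) 1" .
qed

lemma regular_gf_mult_euler: "regular_gf l * euler 1 = euler l"
proof -
  have "{j. 0 < j \<and> 1 dvd j} = {j::nat. 0 < j \<and> \<not> l dvd j} \<union> {j. 0 < j \<and> l dvd j}" by auto
  moreover have "{j::nat. 0 < j \<and> \<not> l dvd j} \<inter> {j. 0 < j \<and> l dvd j} = {}" by auto
  ultimately have "euler 1 = eprod {j. 0 < j \<and> \<not> l dvd j} * euler l"
    unfolding euler_def by (simp only: eprod_Un)
  then show ?thesis using regular_gf_mult_eprod[of l] by (simp flip: mult.assoc)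
qed

lemma regular_gf_mult_square_series: "regular_gf 3 * square_series = (euler 1)\<^sup>2"
proof -
  have "euler 3 * (regular_gf 3 * square_series) = regular_gf 3 * (euler 1) ^ 3"
    by (simp add: euler_1_power3 mult_ac del: One_nat_def)
  also have "\<dots> = euler 3 * (euler 1)\<^sup>2"
    using regular_gf_mult_euler[of 3] by (metis mult.assoc power2_eq_square power3_eq_cube)
  finally show ?thesis by simp
qed

section \<open>The even part of the generating function\<close>

text \<open>Frobenius: squaring is additive and fixes the coefficients 0 and 1. Truncation reduces
  the claim to finite sums of monomials.\<close>

lemma bit_fps_power2_eq_compose: "F\<^sup>2 = F oo fps_X\<^sup>2" for F :: "bit fps"
proof (rule fps_eqI_agree)
  fix n
  let ?t = "\<lambda>i. fps_const (fps_nth F i) * fps_X ^ i"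
  have F: "fps_agree n F (\<Sum>i<n. ?t i)"
    by (simp add: fps_agree_def fps_sum_nth mult_delta_right)
  have sq: "(\<Sum>i\<in>A. ?t i)\<^sup>2 = (\<Sum>i\<in>A. (?t i)\<^sup>2)" for A
    by (induction A rule: infinite_finite_induct) (simp_all add: bit_fps_power2_add)
  have t: "(?t i)\<^sup>2 = ?t i oo fps_X\<^sup>2" for i
    by (cases "fps_nth F i") (simp_all add: fps_compose_power_X_power mult.commute flip: power_mult)
  have "fps_agree n (F\<^sup>2) ((\<Sum>i<n. ?t i)\<^sup>2)"
    unfolding power2_eq_square by (intro fps_agree_mult F)
  also have "\<dots> = (\<Sum>i<n. ?t i) oo fps_X\<^sup>2"
    by (simp only: sq t fps_compose_sum_distrib)
  also have "fps_agree n \<dots> (F oo fps_X\<^sup>2)"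
    by (intro fps_agree_compose_X_power fps_agree_sym[OF F]) simp
  finally show "fps_agree n (F\<^sup>2) (F oo fps_X\<^sup>2)" .
qed

lemma bit_fps_power2_nth: "fps_nth (F\<^sup>2) n = (if even n then fps_nth F (n div 2) else 0)"
  for F :: "bit fps"
  by (subst bit_fps_power2_eq_compose) (simp add: fps_compose_X_power_nth)

text \<open>An even square \<open>2 * n = m^2\<close> has \<open>m = 2 * l\<close> and
  \<open>n = 2 * l^2\<close>, and 3 divides \<open>m\<close> exactly if it divides \<open>l\<close>.
  The fourth power is \<open>S(q^4)\<close>.\<close>

lemma square_series_power4_nth:
  "fps_nth (square_series ^ 4) (2 * n) = fps_nth square_series (2 * n)"
proof -
  have "fps_nth (square_series ^ 4) (2 * n) = fps_nth ((square_series\<^sup>2)\<^sup>2) (2 * n)"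
    by (simp flip: power_mult)
  also have "\<dots> = (if even n then fps_nth square_series (n div 2) else 0)"
    by (simp only: bit_fps_power2_nth) simp
  also have "\<dots> = fps_nth square_series (2 * n)"
  proof -
    have "(\<exists>m. \<not> 3 dvd m \<and> 2 * n = m\<^sup>2) \<longleftrightarrow> even n \<and> (\<exists>m. \<not> 3 dvd m \<and> n div 2 = m\<^sup>2)"
    proof
      assume "\<exists>m. \<not> 3 dvd m \<and> 2 * n = m\<^sup>2"
      then obtain m where m: "\<not> 3 dvd m" "2 * n = m\<^sup>2" by auto
      then have "even (m\<^sup>2)" by (metis dvd_triv_left)
      then obtain l where "m = 2 * l" by auto
      then have "n = 2 * l\<^sup>2" "\<not> 3 dvd l" using m by (auto simp: power_mult_distrib)
      then show "even n \<and> (\<exists>m. \<not> 3 dvd m \<and> n div 2 = m\<^sup>2)" by auto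
    next
      assume "even n \<and> (\<exists>m. \<not> 3 dvd m \<and> n div 2 = m\<^sup>2)"
      then obtain m where m: "even n" "\<not> 3 dvd m" "n div 2 = m\<^sup>2" by auto
      then have "2 * n = (2 * m)\<^sup>2" by (auto simp: power_mult_distrib)
      moreover have "\<not> 3 dvd 2 * m" using m(2) by presburger
      ultimately show "\<exists>m. \<not> 3 dvd m \<and> 2 * n = m\<^sup>2" by blast
    qed
    then show ?thesis by (auto simp: square_series_def)
  qed
  finally show ?thesis .
qed

text \<open>With \<open>H = f_1 / S\<close> the generating function is \<open>H^2 * S\<close>. Here
  \<open>S = R + S^4\<close> with \<open>R\<close> odd; as \<open>H^2\<close> is even,
  \<open>H^2 * R\<close> is odd, leaving \<open>H^2 * S^4 = (f_1 * S)^2\<close>.\<close>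

lemma regular_gf_even_part:
  "fps_nth (regular_gf 3) (2 * n) = fps_nth (euler 1 * square_series) n"
proof -
  define R where "R = square_series + square_series ^ 4"
  define H where "H = euler 1 * inverse square_series"
  have "fps_nth square_series 0 \<noteq> 0" by (simp add: square_series_def)
  then have inv: "inverse square_series * square_series = 1" by (rule inverse_mult_eq_1)
  have "R + square_series ^ 4 = square_series + 2 * square_series ^ 4"
    unfolding R_def by (simp only: mult_2 add.assoc)
  then have R: "square_series = R + square_series ^ 4" by simp
  have "regular_gf 3 = regular_gf 3 * (inverse square_series * square_series)"
    by (simp add: inv)
  also have "\<dots> = (euler 1)\<^sup>2 * inverse square_series"
    using regular_gf_mult_square_series by (metis mult.assoc mult.commute)
  also have "\<dots> = (euler 1)\<^sup>2 * inverse square_series * (inverse square_series * square_series)"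
    by (simp add: inv)
  also have "\<dots> = H\<^sup>2 * square_series"
    by (simp add: H_def power2_eq_square mult_ac)
  also have "\<dots> = H\<^sup>2 * R + H\<^sup>2 * square_series ^ 4"
    by (subst R) (simp add: algebra_simps)
  also have "H\<^sup>2 * square_series ^ 4 = (inverse square_series * square_series)\<^sup>2 * (euler 1 * square_series)\<^sup>2"
    by (simp add: H_def power2_eq_square power4_eq_xxxx mult_ac)
  finally have gf: "regular_gf 3 = H\<^sup>2 * R + (euler 1 * square_series)\<^sup>2"
    by (simp add: inv)
  have "fps_nth R (2 * i) = 0" for i
    by (simp add: R_def square_series_power4_nth)
  then have "fps_nth (H\<^sup>2) i * fps_nth R (2 * n - i) = 0" if "i \<le> 2 * n" for i
  proof (cases "even i")
    case True
    then have "2 * n - i = 2 * (n - i div 2)" by (auto elim!: evenE)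
    then show ?thesis using \<open>\<And>i. fps_nth R (2 * i) = 0\<close> by simp
  qed (simp add: bit_fps_power2_nth)
  then have "fps_nth (H\<^sup>2 * R) (2 * n) = 0"
    unfolding fps_mult_nth by (intro sum.neutral) simp
  then show ?thesis unfolding gf by (simp add: bit_fps_power2_nth)
qed

section \<open>Counting representations\<close>

text \<open>
  A representation \<open>24 * n + 1 = x\<^sup>2 + 24 * m\<^sup>2\<close> is recorded by the pentagonal number \<open>i\<close> with
  \<open>x\<^sup>2 = 24 * i + 1\<close>.
\<close>
definition reps :: "nat \<Rightarrow> nat set" where
  "reps n = {i. i \<le> n \<and> i \<in> range (texp 1 2) \<and> (n - i = 0 \<or> (\<exists>m. \<not> 3 dvd m \<and> n - i = m\<^sup>2))}"

text \<open>Both factors \<open>f_1\<close> and \<open>S\<close> have indicator coefficients, so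
  their Cauchy product is a count.\<close>

lemma of_nat_b_3_double: "of_nat (b 3 (2 * n)) = (of_nat (card (reps n)) :: bit)"
proof -
  have "of_nat (b 3 (2 * n)) = fps_nth (theta 1 2 * square_series) n"
    using regular_gf_even_part[of n] by (simp add: regular_gf_def theta_1_2 del: One_nat_def)
  also have "\<dots> = (\<Sum>i=0..n. of_bool (i \<in> reps n))"
    unfolding fps_mult_nth
    by (intro sum.cong) (auto simp: theta_def square_series_def reps_def simp flip: of_bool_conj)
  also have "\<dots> = of_nat (card ({0..n} \<inter> reps n))"
    by (simp add: Int_def sum.If_cases of_bool_def)
  also have "{0..n} \<inter> reps n = reps n" by (auto simp: reps_def)
  finally show ?thesis .
qed

lemma bit_of_nat_eq_iff: "of_nat m = (of_nat n :: bit) \<longleftrightarrow> [m = n] (mod 2)"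
proof -
  have "of_nat k = (of_bool (odd k) :: bit)" for k
    by (induction k) auto
  then show ?thesis by (auto simp: cong_def mod2_eq_if)
qed

text \<open>Completing the square gives \<open>x = 6 * k - 1\<close>; conversely \<open>x\<close> is
  prime to 6, so \<open>x\<close> or \<open>- x\<close> has this form.\<close>

lemma pentagonal_iff: "i \<in> range (texp 1 2) \<longleftrightarrow> (\<exists>x. 24 * int i + 1 = x\<^sup>2)"
proof
  assume "i \<in> range (texp 1 2)"
  then obtain k where "2 * int i = 3 * k\<^sup>2 - k" by (auto simp: in_range_texp_iff)
  then have "24 * int i + 1 = (6 * k - 1)\<^sup>2" by (simp add: power2_eq_square algebra_simps)
  then show "\<exists>x. 24 * int i + 1 = x\<^sup>2" ..
next
  assume "\<exists>x. 24 * int i + 1 = x\<^sup>2"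
  then obtain x where x: "24 * int i + 1 = x\<^sup>2" ..
  have "odd y \<and> \<not> 3 dvd y" if "24 * int i + 1 = y" for y using that by presburger
  with x have "odd (x\<^sup>2)" "\<not> 3 dvd x\<^sup>2" by blast+
  then have "odd x" "\<not> 3 dvd x" by (auto simp: power2_eq_square)
  then have "x mod 6 = 1 \<or> x mod 6 = 5" by presburger
  then obtain k where "x = 6 * k - 1 \<or> x = - (6 * k - 1)"
  proof
    assume "x mod 6 = 1"
    then have "x = - (6 * (- (x div 6)) - 1)" by presburger
    then show ?thesis using that by blast
  next
    assume "x mod 6 = 5"
    then have "x = 6 * (x div 6 + 1) - 1" by presburger
    then show ?thesis using that by blast
  qed
  then have "x\<^sup>2 = (6 * k - 1)\<^sup>2" by (metis power2_minus)
  then have "2 * int i = 3 * k\<^sup>2 - k" using x by (simp add: power2_eq_square algebra_simps)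
  then show "i \<in> range (texp 1 2)" unfolding in_range_texp_iff by (intro exI[of _ k]) simp
qed

section \<open>Descent modulo 17\<close>

text \<open>Modulo 17 the form is \<open>x^2 + 7 * m^2\<close>, and \<open>-7\<close> is a
  nonresidue; the proof checks all pairs from the list of squares.\<close>

lemma dvd_17_of_form:
  fixes x m :: int
  assumes "17 dvd x\<^sup>2 + 24 * m\<^sup>2"
  shows "17 dvd x" "17 dvd m"
proof -
  have sq: "z\<^sup>2 mod 17 \<in> {0, 1, 2, 4, 8, 9, 13, 15, 16}" for z :: int
  proof -
    have "z mod 17 \<in> {0..16}" by simp
    also have "{0..16::int} = {0,1,2,3,4,5,6,7,8,9,10,11,12,13,14,15,16}" by (auto, presburger)
    finally have "(z mod 17)\<^sup>2 mod 17 \<in> {0, 1, 2, 4, 8, 9, 13, 15, 16}" by auto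
    then show ?thesis by (simp add: power_mod)
  qed
  have "17 dvd (x\<^sup>2 + 24 * m\<^sup>2) - 17 * m\<^sup>2" by (rule dvd_diff[OF assms dvd_triv_left])
  then have "17 dvd x\<^sup>2 + 7 * m\<^sup>2" by (simp add: add.commute)
  then have "(x\<^sup>2 + 7 * m\<^sup>2) mod 17 = 0" by (rule dvd_imp_mod_0)
  then have "(x\<^sup>2 mod 17 + 7 * (m\<^sup>2 mod 17)) mod 17 = 0"
    by (metis mod_add_left_eq mod_add_right_eq mod_mult_right_eq)
  then have "x\<^sup>2 mod 17 = 0 \<and> m\<^sup>2 mod 17 = 0"
  proof -
    have "u = 0 \<and> v = 0"
      if "u \<in> {0, 1, 2, 4, 8, 9, 13, 15, 16}" "v \<in> {0, 1, 2, 4, 8, 9, 13, 15, 16}" "(u + 7 * v) mod 17 = 0"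
      for u v :: int
      using that by auto
    from this[OF sq sq] show ?thesis
      using \<open>(x\<^sup>2 mod 17 + 7 * (m\<^sup>2 mod 17)) mod 17 = 0\<close> .
  qed
  then have "17 dvd x\<^sup>2" "17 dvd m\<^sup>2" by auto
  moreover have "prime (17::int)" by simp
  ultimately show "17 dvd x" "17 dvd m" using prime_dvd_power by blast+
qed

text \<open>Multiply \<open>x\<close> and \<open>m\<close> by 17: since
  \<open>24 * 12 + 1 = 289\<close>, the map \<open>i \<mapsto> 289 * i + 12\<close> multiplies
  \<open>24 * i + 1\<close> by 289.\<close>

lemma reps_scale: "reps (289 * n + 12) \<supseteq> (\<lambda>i. 289 * i + 12) ` reps n"
proof (rule image_subsetI)
  fix i assume "i \<in> reps n"
  then have i: "i \<le> n" "i \<in> range (texp 1 2)" "n - i = 0 \<or> (\<exists>m. \<not> 3 dvd m \<and> n - i = m\<^sup>2)"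
    by (auto simp: reps_def)
  obtain x where "24 * int i + 1 = x\<^sup>2" using i(2) pentagonal_iff by auto
  then have "24 * int (289 * i + 12) + 1 = (17 * x)\<^sup>2" by (simp add: power_mult_distrib)
  then have "289 * i + 12 \<in> range (texp 1 2)" using pentagonal_iff by blast
  moreover have "(289 * n + 12) - (289 * i + 12) = 289 * (n - i)" using i(1) by simp
  moreover have "289 * m\<^sup>2 = (17 * m)\<^sup>2" "3 dvd 17 * m \<longleftrightarrow> 3 dvd m" for m :: nat
    by (simp add: power_mult_distrib) presburger
  ultimately show "289 * i + 12 \<in> reps (289 * n + 12)"
    using i(1,3) unfolding reps_def by (auto, metis)
qed

text \<open>Here \<open>x^2 + 24 * m^2 = 17 * (24 * n + 17)\<close>, so 17 divides \<open>x\<close>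
  and \<open>m\<close>. Then 289 divides the right side, which forces 17 to divide
  \<open>n\<close>.\<close>

lemma reps_descent:
  assumes "i \<in> reps (17 * n + 12)"
  shows "17 dvd n" "i \<in> (\<lambda>i. 289 * i + 12) ` reps (n div 17)"
proof -
  have i: "i \<le> 17 * n + 12" "i \<in> range (texp 1 2)" using assms by (auto simp: reps_def)
  obtain x where x: "24 * int i + 1 = x\<^sup>2" using i(2) pentagonal_iff by auto
  obtain m where m: "17 * n + 12 - i = m\<^sup>2" "m = 0 \<or> \<not> 3 dvd m"
    using assms unfolding reps_def by (auto intro: that[of 0])
  have mi: "int (m\<^sup>2) = 17 * int n + 12 - int i" using m(1) i(1) by linarith
  have "x\<^sup>2 + 24 * (int m)\<^sup>2 = 17 * (24 * int n + 17)"
    using x mi by simp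
  then have "17 dvd x\<^sup>2 + 24 * (int m)\<^sup>2" by simp
  from dvd_17_of_form[OF this] obtain y l where y: "x = 17 * y" and "int m = 17 * l"
    by (auto elim!: dvdE)
  then have "17 dvd m" by presburger
  then obtain l where l: "m = 17 * l" ..
  have yi: "24 * int i + 1 = 289 * y\<^sup>2" using x y by (simp add: power_mult_distrib)
  then obtain i' where i': "i = 289 * i' + 12"
  proof -
    \<comment> \<open>From \<open>24 * i + 1 = 289 * y^2\<close> follows
      \<open>288 * i + 12 = 289 * (12 * y^2)\<close>, which yields this quotient.\<close>
    define t where "t = int i - 12 * y\<^sup>2"
    have "int i = 289 * t + 12"
    proof -
      have "289 * t + 12 = 289 * int i - 12 * (289 * y\<^sup>2) + 12" by (simp add: t_def)
      then show ?thesis unfolding yi[symmetric] by simp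
    qed
    moreover from this have "0 \<le> t" using of_nat_0_le_iff[of i] by linarith
    ultimately have "i = 289 * nat t + 12" by linarith
    then show ?thesis using that by blast
  qed
  then have "24 * int i' + 1 = y\<^sup>2" using yi by simp
  then have "i' \<in> range (texp 1 2)" using pentagonal_iff by blast
  moreover have n: "n = 17 * (l\<^sup>2 + i')"
    using m(1) i(1) l i' by (simp add: power_mult_distrib)
  moreover have "l = 0 \<or> \<not> 3 dvd l" using m(2) l by auto
  ultimately have "i' \<in> reps (n div 17)"
    unfolding reps_def by auto
  then show "i \<in> (\<lambda>i. 289 * i + 12) ` reps (n div 17)" using i' by blast
  show "17 dvd n" using n by simp
qed

lemma card_reps: "card (reps (17 * n + 12)) = (if 17 dvd n then card (reps (n div 17)) else 0)"
proof (cases "17 dvd n")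
  case True
  then obtain k where k: "n = 17 * k" ..
  have "reps (17 * n + 12) = (\<lambda>i. 289 * i + 12) ` reps k"
    using reps_descent(2)[of _ n] reps_scale[of k] k by auto
  then show ?thesis using k by (simp add: card_image inj_on_def)
next
  case False
  then have "reps (17 * n + 12) = {}" using reps_descent(1) by blast
  then show ?thesis using False by simp
qed

section \<open>The congruences for \<open>b 3\<close>\<close>

lemma b_3_cong: "[b 3 (34 * n + 24) = (if 17 dvd n then b 3 (2 * (n div 17)) else 0)] (mod 2)"
proof -
  have "of_nat (b 3 (34 * n + 24)) = (of_nat (card (reps (17 * n + 12))) :: bit)"
    using of_nat_b_3_double[of "17 * n + 12"] by simp
  then show ?thesis
    unfolding bit_of_nat_eq_iff[symmetric] by (simp add: card_reps of_nat_b_3_double)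
qed

text \<open>Induction with \<open>j = k - 1\<close>: if the argument at \<open>j\<close> is
  \<open>2 * c\<close>, the next one is \<open>34 * (17 * c) + 24\<close>, so
  \<open>b_3_cong\<close> links their parities. At \<open>j = 0\<close> the index
  \<open>17 * n + 1\<close> is prime to 17.\<close>

lemma b_3_vanish:
  "[b 3 (2 * 17 ^ (2 * Suc j) * n + 17 ^ (2 * j) * 58 + 24 * ((17 ^ (2 * j) - 1) div 288)) = 0] (mod 2)"
proof (induction j)
  case 0
  have "\<not> 17 dvd 17 * n + 1" by presburger
  then show ?case using b_3_cong[of "17 * n + 1"] by (simp add: algebra_simps)
next
  case (Suc j)
  have "288 dvd (17::nat) ^ (2 * j) - 1" using dvd_288[of "Suc j"] by simp
  then obtain t where "(17::nat) ^ (2 * j) - 1 = 288 * t" ..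
  moreover have "(17::nat) ^ (2 * j) \<ge> 1" by simp
  ultimately have t: "(17::nat) ^ (2 * j) = 288 * t + 1" by linarith
  \<comment> \<open>Half of the argument at \<open>j\<close>, with \<open>17 ^ (2 * j)\<close>
    written as \<open>288 * t + 1\<close>.\<close>
  define c where "c = 289 * (288 * t + 1) * n + 29 * (288 * t + 1) + 12 * t"
  have old: "2 * 17 ^ (2 * Suc j) * n + 17 ^ (2 * j) * 58 + 24 * ((17 ^ (2 * j) - 1) div 288) = 2 * c"
    by (simp add: t c_def)
  have new: "2 * 17 ^ (2 * Suc (Suc j)) * n + 17 ^ (2 * Suc j) * 58 + 24 * ((17 ^ (2 * Suc j) - 1) div 288)
      = 34 * (17 * c) + 24"
  proof -
    have "(17::nat) ^ (2 * Suc j) = 288 * (289 * t + 1) + 1" using t by simp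
    moreover have "(17::nat) ^ (2 * Suc (Suc j)) = 289 * (289 * (288 * t + 1))" using t by simp
    ultimately show ?thesis by (simp add: c_def algebra_simps)
  qed
  have "[b 3 (34 * (17 * c) + 24) = b 3 (2 * c)] (mod 2)"
    using b_3_cong[of "17 * c"] by simp
  then show ?case
    unfolding new by (rule cong_trans) (rule Suc[unfolded old])
qed

theorem theorem1p2:
  shows "fps_cong
           (Abs_fps (\<lambda>n. int (b 3 (34 * n + 24))))
           (fps_compose (Abs_fps (\<lambda>n. int (b 3 (2 * n)))) (fps_X ^ 17))
           2
       \<and> (\<forall>n::nat. [b 3 (2 * 17 ^ 2 * n + 58) = 0] (mod 2))
       \<and> (\<forall>k n :: nat. k \<ge> 1 \<longrightarrow>
            [b 3 (2 * 17 ^ (2 * k) * n + 17 ^ (2 * k - 2) * 58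
                  + 24 * ((17 ^ (2 * k - 2) - 1) div 288)) = 0] (mod 2))"
proof (intro conjI allI impI)
  have "[int (b 3 (34 * n + 24)) = (if 17 dvd n then int (b 3 (2 * (n div 17))) else 0)] (mod 2)" for n
  proof -
    have "[int (b 3 (34 * n + 24)) = int (if 17 dvd n then b 3 (2 * (n div 17)) else 0)] (mod int 2)"
      by (simp only: cong_int_iff b_3_cong)
    then show ?thesis by (cases "17 dvd n") simp_all
  qed
  then show "fps_cong (Abs_fps (\<lambda>n. int (b 3 (34 * n + 24))))
      (fps_compose (Abs_fps (\<lambda>n. int (b 3 (2 * n)))) (fps_X ^ 17)) 2"
    unfolding fps_cong_def by (simp only: fps_compose_X_power_nth fps_nth_Abs_fps) simp
next
  fix n :: nat
  show "[b 3 (2 * 17 ^ 2 * n + 58) = 0] (mod 2)"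
    using b_3_vanish[of 0 n] by simp
next
  fix k n :: nat
  assume "k \<ge> 1"
  then obtain j where "k = Suc j" by (cases k) auto
  then show "[b 3 (2 * 17 ^ (2 * k) * n + 17 ^ (2 * k - 2) * 58
      + 24 * ((17 ^ (2 * k - 2) - 1) div 288)) = 0] (mod 2)"
    using b_3_vanish[of j n] by simp
qed

end
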